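(* Let $n \ge 2$ and let $a_1,\dots,a_n$ be positive integers such that $a_1 a_2 \cdots a_n$ is odd. Then there is no closed knight's tour in the $n$-dimensional $a_1 \times a_2 \times \cdots \times a_n$ hypercuboid. In particular, there is no closed knight's tour in an $n$-dimensional hypercube of odd order.
   Context: The $n$-dimensional $a_1\times\cdots\times a_n$ hypercuboid is the lattice of cells $\{1,\dots,a_1\}\times\cdots\times\{1,\dots,a_n\}$; the $n$-dimensional hypercube of order $m$ is the case $a_1=\cdots=a_n=m$. A knight's move goes from one cell to another cell such that their coordinates differ by exactly $2$ in absolute value in one coordinate, by exactly $1$ in absolute value in another coordinate, and agree in all remaining coordinates. A knight's tour is a sequence of knight's moves that visits every cell exactly once. The tour is closed if its initial cell and its last cell are connected by a knight's move. *)

theory Defs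
  imports Main "HOL-Library.FuncSet"
begin

(* A cell of an n-dimensional hypercuboid is a coordinate function on {1..n}; extensionality
   (PiE) makes equality of cells coincide with equality of all n coordinates. *)

definition hypercuboid :: "nat \<Rightarrow> (nat \<Rightarrow> nat) \<Rightarrow> (nat \<Rightarrow> nat) set" where
  "hypercuboid n a = (\<Pi>\<^sub>E i\<in>{1..n}. {1..a i})"

definition hypercube :: "nat \<Rightarrow> nat \<Rightarrow> (nat \<Rightarrow> nat) set" where
  "hypercube n m = hypercuboid n (\<lambda>i. m)"

definition knight_move :: "nat \<Rightarrow> (nat \<Rightarrow> nat) \<Rightarrow> (nat \<Rightarrow> nat) \<Rightarrow> bool" where
  "knight_move n x y \<longleftrightarrow>
    (\<exists>i\<in>{1..n}. \<exists>j\<in>{1..n}. i \<noteq> j \<and>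
       \<bar>int (x i) - int (y i)\<bar> = 2 \<and>
       \<bar>int (x j) - int (y j)\<bar> = 1 \<and>
       (\<forall>k\<in>{1..n} - {i, j}. x k = y k))"

definition knights_tour :: "nat \<Rightarrow> (nat \<Rightarrow> nat) set \<Rightarrow> (nat \<Rightarrow> nat) list \<Rightarrow> bool" where
  "knights_tour n B cs \<longleftrightarrow> distinct cs \<and> set cs = B \<and> successively (knight_move n) cs"

definition closed_knights_tour :: "nat \<Rightarrow> (nat \<Rightarrow> nat) set \<Rightarrow> (nat \<Rightarrow> nat) list \<Rightarrow> bool" where
  "closed_knights_tour n B cs \<longleftrightarrow>
    knights_tour n B cs \<and> cs \<noteq> [] \<and> knight_move n (last cs) (hd cs)"

end

theory Submission
  imports Defs
begin

text \<open>A knight's move changes the sum of the coordinates by an odd amount, so the parities of this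
  sum alternate along a closed tour, which therefore has even length. But its length is the number
  of cells \<open>a\<^sub>1 \<cdots> a\<^sub>n\<close>.\<close>

text \<open>The coordinate that moves by 2 keeps its parity, the one that moves by 1 changes it, and
  all others are fixed.\<close>

lemma knight_move_flips_parity:
  assumes "knight_move n x y"
  shows "even (\<Sum>k=1..n. x k) \<longleftrightarrow> odd (\<Sum>k=1..n. y k)"
proof -
  obtain i j where i: "i \<in> {1..n}" and j: "j \<in> {1..n}" and "i \<noteq> j"
    and di: "\<bar>int (x i) - int (y i)\<bar> = 2" and dj: "\<bar>int (x j) - int (y j)\<bar> = 1"
    and eq: "\<forall>k\<in>{1..n} - {i, j}. x k = y k"
    using assms unfolding knight_move_def by blast
  have split: "(\<Sum>k=1..n. z k) = z i + z j + (\<Sum>k\<in>{1..n} - {i, j}. z k)" for z :: "nat \<Rightarrow> nat"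
    using i j \<open>i \<noteq> j\<close> by (subst sum.subset_diff[of "{i, j}"]) auto
  have "(\<Sum>k\<in>{1..n} - {i, j}. x k) = (\<Sum>k\<in>{1..n} - {i, j}. y k)"
    using eq by (intro sum.cong) auto
  moreover have "even (x i) \<longleftrightarrow> even (y i)" "even (x j) \<longleftrightarrow> odd (y j)"
    using di dj by presburger+
  ultimately show ?thesis
    unfolding split[of x] split[of y] even_add by simp blast
qed

text \<open>\<open>P\<close> flips at each of the \<open>length xs - 1\<close> steps, so the two
  ends agree exactly when that number is even.\<close>

lemma successively_alternating_last:
  assumes "successively R xs" "xs \<noteq> []" "\<And>x y. R x y \<Longrightarrow> P x \<longleftrightarrow> \<not> P y"
  shows "(P (last xs) \<longleftrightarrow> P (hd xs)) \<longleftrightarrow> odd (length xs)"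
  using assms(1,2)
proof (induction xs rule: induct_list012)
  case (3 x y zs)
  then show ?case using assms(3)[of x y] by auto
qed auto

text \<open>The closing move gives \<open>last cs\<close> and \<open>hd cs\<close> opposite
  parities; by the alternation along \<open>cs\<close> this excludes odd length.\<close>

lemma even_length_closed_knights_tour:
  assumes "closed_knights_tour n B cs"
  shows "even (length cs)"
  using assms successively_alternating_last
      [of "knight_move n" cs "\<lambda>x. even (\<Sum>k=1..n. x k)", OF _ _ knight_move_flips_parity]
    knight_move_flips_parity[of n "last cs" "hd cs"]
  unfolding closed_knights_tour_def knights_tour_def by blast

lemma card_hypercuboid: "card (hypercuboid n a) = (\<Prod>i=1..n. a i)"
  unfolding hypercuboid_def by (simp add: card_PiE)

lemma no_closed_knights_tour_odd_hypercuboid: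
  assumes "odd (\<Prod>i=1..n. a i)"
  shows "\<not> closed_knights_tour n (hypercuboid n a) cs"
proof
  assume tour: "closed_knights_tour n (hypercuboid n a) cs"
  then have "length cs = (\<Prod>i=1..n. a i)"
    unfolding closed_knights_tour_def knights_tour_def
    by (metis distinct_card card_hypercuboid)
  with even_length_closed_knights_tour[OF tour] assms show False by simp
qed

theorem mainTheorem2:
  fixes n :: nat
  assumes "n \<ge> 2"
  shows "(\<forall>a :: nat \<Rightarrow> nat. (\<forall>i\<in>{1..n}. a i > 0) \<and> odd (\<Prod>i=1..n. a i) \<longrightarrow>
            \<not> (\<exists>cs. closed_knights_tour n (hypercuboid n a) cs)) \<and>
         (\<forall>m :: nat. odd m \<longrightarrow> \<not> (\<exists>cs. closed_knights_tour n (hypercube n m) cs))"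
  \<comment> \<open>For the hypercube take \<open>a\<close> constant: the product is then
    \<open>m ^ n\<close>, which is odd for odd \<open>m\<close>.\<close>
  using no_closed_knights_tour_odd_hypercuboid
    no_closed_knights_tour_odd_hypercuboid[where a = "\<lambda>i. m" for m]
  unfolding hypercube_def by auto

end
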